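(* Let $f_\omega : \mathcal{S} \times \mathcal{A} \to \mathbb{R}$ be a Lipschitz continuous function of state-action pairs, with Lipschitz constant $L$. Then for two different state-action distributions $\rho^{*}$ and $\tilde{\rho}$ on $\mathcal{S}\times\mathcal{A}$, $$\mathbb{E}_{(s,a)\sim \rho^{*}}[f_\omega(s,a)] \ \ge\ \mathbb{E}_{(s,a)\sim \tilde{\rho}}[f_\omega(s,a)] - L\, W_{1}(\rho^{*}, \tilde{\rho}),$$ where $W_{1}(\rho^{*}, \tilde{\rho})$ is the 1-Wasserstein (Earth Mover's) distance between the state-action distributions.
   Context: $\mathcal{S}$ and $\mathcal{A}$ are the state space and action space of a Markov decision process with discount factor $\gamma \in (0,1]$, and $f_\omega$ is a real-valued function with parameters $\omega$ (e.g. a neural network). The state-action (visitation) distribution of a policy $\pi$ is $\rho_\pi(s,a) = \rho_\pi(s)\,\pi(a|s)$, where $\rho_\pi(s) = \sum_{t=0}^{\infty} \gamma^t P(s_t = s \mid \pi)$ is the unnormalized $\gamma$-discounted state-visitation distribution and $P(s_t=s\mid\pi)$ is the probability of being in state $s$ at time $t$ when following $\pi$ from an initial state drawn from the initial state distribution. In the application, $\rho^{*}$ is the state-action visitation distribution of an expert and $\tilde{\rho}$ is that of a surrogate policy. $\mathbb{E}_{(s,a)\sim\rho}[f_\omega(s,a)]$ denotes the integral of $f_\omega$ against $\rho$. Writing $x = s \oplus a$ for the concatenation of state and action, distances between state-action pairs are measured by $\|x'-x\|_1$: the Lipschitz condition is $f_\omega(x') - f_\omega(x) \le L\|x'-x\|_1$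 for any two inputs $x, x'$, and $W_1(\rho^{*}, \tilde{\rho}) = \min_{\mu} \mathbb{E}_{\mu}\|x'-x\|_1$, the minimum being over all joint distributions $\mu$ of $(x,x')$ with marginals $\rho^{*}$ (for $x$) and $\tilde{\rho}$ (for $x'$). *)

theory Defs
  imports "HOL-Probability.Probability"
begin

text \<open>
  States and actions are vectors of two Euclidean spaces, and a state-action pair
  \<open>(s, a) :: 's \<times> 'a\<close> plays the role of the concatenated vector: \<open>Basis\<close> of the product type
  consists of the basis vectors of both factors, so \<open>l1_norm (s, a) = l1_norm s + l1_norm a\<close>.
\<close>

definition l1_norm :: "'v::euclidean_space \<Rightarrow> real" where
  "l1_norm x = (\<Sum>b\<in>Basis. \<bar>x \<bullet> b\<bar>)"

lemma l1_norm_Pair: "l1_norm (s, a) = l1_norm s + l1_norm a"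
proof -
  have inj: "inj_on (\<lambda>u::'a. (u, 0::'b)) Basis" "inj_on (\<lambda>v::'b. (0::'a, v)) Basis"
    by (auto intro: inj_onI)
  show ?thesis
    unfolding l1_norm_def Basis_prod_def
    by (subst sum.union_disjoint)
       (auto simp: sum.reindex[OF inj(1)] sum.reindex[OF inj(2)])
qed

abbreviation borel_on :: "'v::topological_space set \<Rightarrow> 'v measure" where
  "borel_on X \<equiv> restrict_space borel X"

abbreviation state_action_space ::
  "'s::euclidean_space set \<Rightarrow> 'a::euclidean_space set \<Rightarrow> ('s \<times> 'a) measure" where
  "state_action_space S A \<equiv> borel_on S \<Otimes>\<^sub>M borel_on A"


section \<open>Markov decision processes and discounted visitation distributions\<close>

text \<open>
  \<open>p0\<close> is the initial state distribution, \<open>K\<close> the transition kernel and \<open>\<gamma>\<close> the discount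
  factor. Rewards play no role and are left out.
\<close>

definition mdp ::
  "'s::euclidean_space set \<Rightarrow> 'a::euclidean_space set \<Rightarrow> 's measure \<Rightarrow>
   ('s \<times> 'a \<Rightarrow> 's measure) \<Rightarrow> real \<Rightarrow> bool" where
  "mdp S A p0 K \<gamma> \<longleftrightarrow>
     p0 \<in> space (prob_algebra (borel_on S)) \<and>
     K \<in> state_action_space S A \<rightarrow>\<^sub>M prob_algebra (borel_on S) \<and>
     0 < \<gamma> \<and> \<gamma> \<le> 1"

definition policy ::
  "'s::euclidean_space set \<Rightarrow> 'a::euclidean_space set \<Rightarrow> ('s \<Rightarrow> 'a measure) \<Rightarrow> bool" where
  "policy S A \<pi> \<longleftrightarrow> \<pi> \<in> borel_on S \<rightarrow>\<^sub>M prob_algebra (borel_on A)"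

text \<open>The law of the state at time \<open>t\<close> when following \<open>\<pi>\<close>.\<close>

primrec state_at ::
  "'s measure \<Rightarrow> ('s \<times> 'a \<Rightarrow> 's measure) \<Rightarrow> ('s \<Rightarrow> 'a measure) \<Rightarrow> nat \<Rightarrow> 's measure" where
  "state_at p0 K \<pi> 0 = p0"
| "state_at p0 K \<pi> (Suc t) =
     state_at p0 K \<pi> t \<bind> (\<lambda>s. \<pi> s \<bind> (\<lambda>a. K (s, a)))"

text \<open>
  The discounted state-visitation distribution is not normalised: its total mass is
  \<open>1 / (1 - \<gamma>)\<close> for \<open>\<gamma> < 1\<close> and infinite for \<open>\<gamma> = 1\<close>.
\<close>

definition state_visitation ::
  "'s measure \<Rightarrow> ('s \<times> 'a \<Rightarrow> 's measure) \<Rightarrow> real \<Rightarrow> ('s \<Rightarrow> 'a measure) \<Rightarrow> 's measure" where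
  "state_visitation p0 K \<gamma> \<pi> =
     measure_of (space p0) (sets p0)
       (\<lambda>B. \<Sum>t. ennreal (\<gamma> ^ t) * emeasure (state_at p0 K \<pi> t) B)"

text \<open>\<open>\<rho>(s, a) = \<rho>(s) \<pi>(a | s)\<close>, as a measure on pairs.\<close>

definition visitation ::
  "'s::euclidean_space set \<Rightarrow> 'a::euclidean_space set \<Rightarrow> 's measure \<Rightarrow>
   ('s \<times> 'a \<Rightarrow> 's measure) \<Rightarrow> real \<Rightarrow> ('s \<Rightarrow> 'a measure) \<Rightarrow> ('s \<times> 'a) measure" where
  "visitation S A p0 K \<gamma> \<pi> =
     state_visitation p0 K \<gamma> \<pi> \<bind>
       (\<lambda>s. \<pi> s \<bind> (\<lambda>a. return (state_action_space S A) (s, a)))"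

definition visitation_distributions ::
  "'s::euclidean_space set \<Rightarrow> 'a::euclidean_space set \<Rightarrow> 's measure \<Rightarrow>
   ('s \<times> 'a \<Rightarrow> 's measure) \<Rightarrow> real \<Rightarrow> ('s \<times> 'a) measure set" where
  "visitation_distributions S A p0 K \<gamma> = {visitation S A p0 K \<gamma> \<pi> | \<pi>. policy S A \<pi>}"


section \<open>The 1-Wasserstein distance\<close>

text \<open>
  Couplings are measures on pairs \<open>(x, x')\<close> and are not required to be probability measures,
  since the marginals may have any (common) total mass. The first marginal belongs to \<open>x\<close>.
\<close>

definition couplings :: "'x measure \<Rightarrow> 'x measure \<Rightarrow> ('x \<times> 'x) measure set" where
  "couplings M N =
     {\<mu>. sets \<mu> = sets (M \<Otimes>\<^sub>M N) \<and> distr \<mu> M fst = M \<and> distr \<mu> N snd = N}"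

text \<open>
  The least transport cost, possibly infinite. An infimum makes it total; it is the minimum
  whenever an optimal coupling exists.
\<close>

definition W1 :: "'v::euclidean_space measure \<Rightarrow> 'v measure \<Rightarrow> ennreal" where
  "W1 M N = (INF \<mu>\<in>couplings M N. \<integral>\<^sup>+ (x, x'). ennreal (l1_norm (x' - x)) \<partial>\<mu>)"

end

theory Submission
  imports Defs
begin

text \<open>
  If \<open>L > 0\<close>, integrating the Lipschitz inequality against a coupling gives the bound. The other
  cases rest on the two measures having the same total mass, which for visitation distributions
  is \<open>\<Sum>t. \<gamma> ^ t\<close> whatever the policy. If \<open>L = 0\<close>, then \<open>f\<close> is constant, so its two integrals agree
  (even when no coupling has finite cost). The case \<open>L < 0\<close> would force \<open>S \<times> A\<close> to have at most one
  point, where equal total mass makes the measures equal.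
\<close>

section \<open>The l1 norm and integration against couplings\<close>

lemma l1_norm_nonneg: "0 \<le> l1_norm x"
  by (simp add: l1_norm_def sum_nonneg)

lemma l1_norm_minus [simp]: "l1_norm (- x) = l1_norm x"
  by (simp add: l1_norm_def)

lemma l1_norm_eq_0_iff: "l1_norm x = 0 \<longleftrightarrow> x = 0"
  by (auto simp: l1_norm_def sum_nonneg_eq_0_iff euclidean_all_zero_iff)

text \<open>Every coupling moves the two integrals onto one measure, where the Lipschitz inequality
  can be applied pointwise. Dividing by \<open>L\<close> keeps the comparison in
  \<open>ennreal\<close>, so an infinite cost, or an infimum over no couplings at all, needs no
  separate case.\<close>

lemma lipschitz_integral_diff_le_W1:
  fixes f :: "'v::euclidean_space \<Rightarrow> real"
  assumes lip: "\<And>x x'. x \<in> space M \<Longrightarrow> x' \<in> space N \<Longrightarrow> f x' - f x \<le> L * l1_norm (x' - x)"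
    and L: "0 < L"
    and fM: "integrable M f" and fN: "integrable N f"
  shows "ennreal (((\<integral>x. f x \<partial>N) - (\<integral>x. f x \<partial>M)) / L) \<le> W1 M N"
  unfolding W1_def
proof (rule INF_greatest)
  fix \<mu> assume "\<mu> \<in> couplings M N"
  then have sets [measurable_cong]: "sets \<mu> = sets (M \<Otimes>\<^sub>M N)"
    and M: "distr \<mu> M fst = M" and N: "distr \<mu> N snd = N"
    by (auto simp: couplings_def)
  have proj [measurable]: "fst \<in> \<mu> \<rightarrow>\<^sub>M M" "snd \<in> \<mu> \<rightarrow>\<^sub>M N"
    by measurable
  \<comment> \<open>The marginal equations \<open>M\<close> and \<open>N\<close> turn integrals of
    \<open>f\<close> into integrals over \<open>\<mu>\<close>, one per coordinate.\<close>
  have fst_int: "integrable \<mu> (\<lambda>p. f (fst p))"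
    using integrable_distr[of fst \<mu> M f] fM by (simp add: M)
  have snd_int: "integrable \<mu> (\<lambda>p. f (snd p))"
    using integrable_distr[of snd \<mu> N f] fN by (simp add: N)
  have fst_eq: "(\<integral>x. f x \<partial>M) = (\<integral>p. f (fst p) \<partial>\<mu>)"
    using integral_distr[of fst \<mu> M f] fM by (simp add: M)
  have snd_eq: "(\<integral>x. f x \<partial>N) = (\<integral>p. f (snd p) \<partial>\<mu>)"
    using integral_distr[of snd \<mu> N f] fN by (simp add: N)
  define g where "g = (\<lambda>p. (f (snd p) - f (fst p)) / L)"
  have g: "integrable \<mu> g"
    unfolding g_def using fst_int snd_int by simp
  have "((\<integral>x. f x \<partial>N) - (\<integral>x. f x \<partial>M)) / L = (\<integral>p. g p \<partial>\<mu>)"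
    unfolding g_def fst_eq snd_eq using fst_int snd_int by simp
  \<comment> \<open>Passing to the positive part makes the integral a nonnegative one, which can be
    compared with a transport cost that may be infinite.\<close>
  also have "\<dots> \<le> (\<integral>p. max 0 (g p) \<partial>\<mu>)"
    using g by (intro integral_mono) auto
  finally have "ennreal (((\<integral>x. f x \<partial>N) - (\<integral>x. f x \<partial>M)) / L) \<le> ennreal (\<integral>p. max 0 (g p) \<partial>\<mu>)"
    by (rule ennreal_leI)
  also have "\<dots> = (\<integral>\<^sup>+ p. ennreal (max 0 (g p)) \<partial>\<mu>)"
    using g by (intro nn_integral_eq_integral[symmetric]) auto
  also have "\<dots> \<le> (\<integral>\<^sup>+ (x, x'). ennreal (l1_norm (x' - x)) \<partial>\<mu>)"
  proof (rule nn_integral_mono)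
    fix p assume "p \<in> space \<mu>"
    then have "fst p \<in> space M" "snd p \<in> space N"
      by (rule measurable_space[OF proj(1)], rule measurable_space[OF proj(2)])
    from lip[OF this] L have "g p \<le> l1_norm (snd p - fst p)"
      by (simp add: g_def pos_divide_le_eq mult.commute)
    then show "ennreal (max 0 (g p)) \<le> (case p of (x, x') \<Rightarrow> ennreal (l1_norm (x' - x)))"
      by (simp add: split_beta l1_norm_nonneg ennreal_leI)
  qed
  finally show "ennreal (((\<integral>x. f x \<partial>N) - (\<integral>x. f x \<partial>M)) / L)
      \<le> (\<integral>\<^sup>+ (x, x'). ennreal (l1_norm (x' - x)) \<partial>\<mu>)" .
qed

section \<open>Total mass of visitation distributions\<close>

lemma suminf_ennreal_commute:
  fixes f :: "nat \<Rightarrow> nat \<Rightarrow> ennreal"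
  shows "(\<Sum>i. \<Sum>j. f i j) = (\<Sum>j. \<Sum>i. f i j)"
  \<comment> \<open>The sum over \<open>i\<close> is read as an integral over counting measure,
    which commutes with a countable sum of nonnegative functions.\<close>
  using nn_integral_suminf[of "\<lambda>j i. f i j" "count_space UNIV"]
  by (simp add: nn_integral_count_space_nat)

context
  fixes S :: "'s::euclidean_space set" and A :: "'a::euclidean_space set"
    and p0 :: "'s measure" and K :: "'s \<times> 'a \<Rightarrow> 's measure" and \<gamma> :: real
    and \<pi> :: "'s \<Rightarrow> 'a measure"
  assumes mdp: "mdp S A p0 K \<gamma>" and policy: "policy S A \<pi>"
begin

text \<open>Integrating the action out of \<open>K\<close> under \<open>\<pi>\<close> leaves a
  Markov kernel on states, and binding with such a kernel preserves probability measures.\<close>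

lemma state_at_prob_algebra: "state_at p0 K \<pi> t \<in> space (prob_algebra (borel_on S))"
proof (induction t)
  case 0
  then show ?case using mdp by (simp add: mdp_def)
next
  case (Suc t)
  have [measurable]: "K \<in> state_action_space S A \<rightarrow>\<^sub>M prob_algebra (borel_on S)"
    "\<pi> \<in> borel_on S \<rightarrow>\<^sub>M prob_algebra (borel_on A)"
    using mdp policy by (auto simp: mdp_def policy_def)
  have kernel: "(\<lambda>s. \<pi> s \<bind> (\<lambda>a. K (s, a))) \<in> borel_on S \<rightarrow>\<^sub>M prob_algebra (borel_on S)"
    by (rule measurable_bind_prob_space2[where N = "borel_on A"]) measurable
  show ?case
    using sets_bind'[OF Suc kernel] prob_space_bind'[OF Suc kernel] by (simp add: space_prob_algebra)
qed

lemma sets_state_at: "sets (state_at p0 K \<pi> t) = sets (borel_on S)"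
  using state_at_prob_algebra by (simp add: space_prob_algebra)

lemma prob_space_state_at: "prob_space (state_at p0 K \<pi> t)"
  using state_at_prob_algebra by (simp add: space_prob_algebra)

lemma sets_state_visitation: "sets (state_visitation p0 K \<gamma> \<pi>) = sets (borel_on S)"
  unfolding state_visitation_def sets_state_at[of 0, simplified, symmetric]
  by (rule sets.sets_measure_of_eq)

lemma space_state_visitation: "space (state_visitation p0 K \<gamma> \<pi>) = S"
  using sets_eq_imp_space_eq[OF sets_state_visitation] by (simp add: space_restrict_space)

text \<open>Each state law has mass one, so only the discount weights remain, whatever the policy.
  The set function given to \<open>measure_of\<close> must first be shown to be countably additive,
  since otherwise \<open>measure_of\<close> does not return its values.\<close>

lemma emeasure_state_visitation_space:
  "emeasure (state_visitation p0 K \<gamma> \<pi>) S = (\<Sum>t. ennreal (\<gamma> ^ t))"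
proof -
  have p0: "sets p0 = sets (borel_on S)"
    using sets_state_at[of 0] by simp
  then have sp: "space p0 = S"
    by (auto dest: sets_eq_imp_space_eq simp: space_restrict_space)
  have "emeasure (state_visitation p0 K \<gamma> \<pi>) S =
      (\<Sum>t. ennreal (\<gamma> ^ t) * emeasure (state_at p0 K \<pi> t) S)"
    unfolding state_visitation_def
  proof (rule emeasure_measure_of_sigma)
    show "sigma_algebra (space p0) (sets p0)" ..
    show "S \<in> sets p0"
      using sp sets.top[of p0] by simp
    show "positive (sets p0) (\<lambda>B. \<Sum>t. ennreal (\<gamma> ^ t) * emeasure (state_at p0 K \<pi> t) B)"
      by (simp add: positive_def)
    show "countably_additive (sets p0) (\<lambda>B. \<Sum>t. ennreal (\<gamma> ^ t) * emeasure (state_at p0 K \<pi> t) B)"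
    proof (rule countably_additiveI)
      fix B :: "nat \<Rightarrow> 's set"
      assume "range B \<subseteq> sets p0" "disjoint_family B"
      then have "(\<Sum>i. emeasure (state_at p0 K \<pi> t) (B i)) = emeasure (state_at p0 K \<pi> t) (\<Union>i. B i)" for t
        by (intro suminf_emeasure) (simp_all only: p0 sets_state_at)
      moreover have "(\<Sum>i. \<Sum>t. ennreal (\<gamma> ^ t) * emeasure (state_at p0 K \<pi> t) (B i)) =
          (\<Sum>t. ennreal (\<gamma> ^ t) * (\<Sum>i. emeasure (state_at p0 K \<pi> t) (B i)))"
        by (subst suminf_ennreal_commute) (simp only: ennreal_suminf_cmult)
      ultimately show "(\<Sum>i. \<Sum>t. ennreal (\<gamma> ^ t) * emeasure (state_at p0 K \<pi> t) (B i)) =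
          (\<Sum>t. ennreal (\<gamma> ^ t) * emeasure (state_at p0 K \<pi> t) (\<Union>i. B i))"
        by (simp only:)
    qed
  qed
  moreover have "emeasure (state_at p0 K \<pi> t) S = 1" for t
    using prob_space.emeasure_space_1[OF prob_space_state_at[of t]]
      sets_eq_imp_space_eq[OF sets_state_at[of t]] by (simp add: space_restrict_space)
  ultimately show ?thesis by simp
qed

lemma measurable_state_action_kernel:
  "(\<lambda>s. \<pi> s \<bind> (\<lambda>a. return (state_action_space S A) (s, a)))
     \<in> borel_on S \<rightarrow>\<^sub>M prob_algebra (state_action_space S A)"
proof -
  have [measurable]: "\<pi> \<in> borel_on S \<rightarrow>\<^sub>M prob_algebra (borel_on A)"
    using policy by (simp add: policy_def)
  show ?thesis
    by (rule measurable_bind_prob_space2[where N = "borel_on A"]) measurable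
qed

text \<open>\<open>bind\<close> takes a default value over an empty space; this lemma excludes that
  case for the state visitation measure.\<close>

lemma state_space_nonempty: "S \<noteq> {}"
  using prob_space.not_empty[OF prob_space_state_at[of 0]]
    sets_eq_imp_space_eq[OF sets_state_at[of 0]] by (simp add: space_restrict_space)

lemma measurable_state_action_kernel_subprob:
  "(\<lambda>s. \<pi> s \<bind> (\<lambda>a. return (state_action_space S A) (s, a)))
     \<in> state_visitation p0 K \<gamma> \<pi> \<rightarrow>\<^sub>M subprob_algebra (state_action_space S A)"
  using measurable_prob_algebraD[OF measurable_state_action_kernel]
  by (simp only: measurable_cong_sets[OF sets_state_visitation refl])

lemma sets_visitation:
  "sets (visitation S A p0 K \<gamma> \<pi>) = sets (state_action_space S A)"
  unfolding visitation_def
  by (rule sets_bind_measurable[OF measurable_state_action_kernel_subprob])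
     (simp add: space_state_visitation state_space_nonempty)

text \<open>Given the state, the law of the pair has mass one, so attaching actions does not change
  the total mass, even when it is infinite.\<close>

lemma emeasure_visitation_space:
  "emeasure (visitation S A p0 K \<gamma> \<pi>) (space (state_action_space S A)) = (\<Sum>t. ennreal (\<gamma> ^ t))"
proof -
  let ?V = "state_visitation p0 K \<gamma> \<pi>" and ?SA = "state_action_space S A"
  let ?k = "\<lambda>s. \<pi> s \<bind> (\<lambda>a. return ?SA (s, a))"
  have "emeasure (visitation S A p0 K \<gamma> \<pi>) (space ?SA) =
      (\<integral>\<^sup>+ s. emeasure (?k s) (space ?SA) \<partial>?V)"
    unfolding visitation_def
    by (rule emeasure_bind[OF _ measurable_state_action_kernel_subprob])
       (simp_all add: space_state_visitation state_space_nonempty)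
  also have "\<dots> = (\<integral>\<^sup>+ s. 1 \<partial>?V)"
  proof (rule nn_integral_cong)
    fix s assume "s \<in> space ?V"
    then have "?k s \<in> space (prob_algebra ?SA)"
      by (intro measurable_space[OF measurable_state_action_kernel])
         (simp add: space_state_visitation space_restrict_space)
    then have "prob_space (?k s)" "sets (?k s) = sets ?SA"
      by (simp_all add: space_prob_algebra)
    then show "emeasure (?k s) (space ?SA) = 1"
      using prob_space.emeasure_space_1 sets_eq_imp_space_eq by metis
  qed
  also have "\<dots> = (\<Sum>t. ennreal (\<gamma> ^ t))"
    by (simp add: space_state_visitation emeasure_state_visitation_space)
  finally show ?thesis .
qed

end

section \<open>The inequality, by the sign of \<open>L\<close>\<close>

theorem proposition1:
  fixes S :: "'s::euclidean_space set" and A :: "'a::euclidean_space set"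
    and p0 :: "'s measure" and K :: "'s \<times> 'a \<Rightarrow> 's measure" and \<gamma> :: real
    and f :: "'s \<times> 'a \<Rightarrow> real" and L :: real
    and \<rho>\<^sub>1 \<rho>\<^sub>2 :: "('s \<times> 'a) measure"
  assumes mdp: "mdp S A p0 K \<gamma>"
    and lipschitz: "\<And>x x'. x \<in> S \<times> A \<Longrightarrow> x' \<in> S \<times> A \<Longrightarrow> f x' - f x \<le> L * l1_norm (x' - x)"
    and distributions:
      "{\<rho>\<^sub>1, \<rho>\<^sub>2} \<subseteq> visitation_distributions S A p0 K \<gamma> \<or>
       {\<rho>\<^sub>1, \<rho>\<^sub>2} \<subseteq> space (prob_algebra (state_action_space S A))"
    and different: "\<rho>\<^sub>1 \<noteq> \<rho>\<^sub>2"
    and integrable: "integrable \<rho>\<^sub>1 f" "integrable \<rho>\<^sub>2 f"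
  shows "ereal (\<integral>x. f x \<partial>\<rho>\<^sub>1) \<ge> ereal (\<integral>x. f x \<partial>\<rho>\<^sub>2) - ereal L * enn2ereal (W1 \<rho>\<^sub>1 \<rho>\<^sub>2)"
proof -
  let ?SA = "state_action_space S A"
  have space_SA: "space ?SA = S \<times> A"
    by (simp add: space_pair_measure space_restrict_space)
  \<comment> \<open>Both alternatives of \<open>distributions\<close> enter the rest of the proof
    only through this common sigma-algebra and common mass.\<close>
  have "sets \<rho>\<^sub>1 = sets ?SA \<and> sets \<rho>\<^sub>2 = sets ?SA \<and>
      emeasure \<rho>\<^sub>1 (space ?SA) = emeasure \<rho>\<^sub>2 (space ?SA)"
    using distributions
  proof
    assume "{\<rho>\<^sub>1, \<rho>\<^sub>2} \<subseteq> visitation_distributions S A p0 K \<gamma>"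
    then show ?thesis
      using sets_visitation[OF mdp] emeasure_visitation_space[OF mdp]
      by (auto simp: visitation_distributions_def)
  next
    assume "{\<rho>\<^sub>1, \<rho>\<^sub>2} \<subseteq> space (prob_algebra ?SA)"
    then have "prob_space \<rho>\<^sub>1" "prob_space \<rho>\<^sub>2" "sets \<rho>\<^sub>1 = sets ?SA" "sets \<rho>\<^sub>2 = sets ?SA"
      by (auto simp: space_prob_algebra)
    then show ?thesis
      using prob_space.emeasure_space_1 sets_eq_imp_space_eq by metis
  qed
  then have sets: "sets \<rho>\<^sub>1 = sets ?SA" "sets \<rho>\<^sub>2 = sets ?SA"
    and mass: "emeasure \<rho>\<^sub>1 (S \<times> A) = emeasure \<rho>\<^sub>2 (S \<times> A)"
    by (auto simp: space_SA)
  have space: "space \<rho>\<^sub>1 = S \<times> A" "space \<rho>\<^sub>2 = S \<times> A"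
    using sets[THEN sets_eq_imp_space_eq] space_SA by auto
  \<comment> \<open>This covers the empty space as well, so two applications yield distinct
    points.\<close>
  have "\<not> S \<times> A \<subseteq> {x}" for x
  proof
    assume sub: "S \<times> A \<subseteq> {x}"
    have "\<rho>\<^sub>1 = \<rho>\<^sub>2"
    proof (rule measure_eqI)
      fix X assume "X \<in> sets \<rho>\<^sub>1"
      then have "X \<subseteq> S \<times> A"
        using sets.sets_into_space space by metis
      then have "X = {} \<or> X = S \<times> A"
        using sub by blast
      then show "emeasure \<rho>\<^sub>1 X = emeasure \<rho>\<^sub>2 X"
        using mass by auto
    qed (simp add: sets)
    with different show False ..
  qed
  then obtain x y where xy: "x \<in> S \<times> A" "y \<in> S \<times> A" "x \<noteq> y"
    by blast
  have "0 \<le> L"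
  proof -
    have "l1_norm (x - y) = l1_norm (y - x)"
      using l1_norm_minus[of "x - y"] by simp
    \<comment> \<open>The Lipschitz inequalities in the two directions add up to a nonnegative
      multiple of this product.\<close>
    then have "0 \<le> L * l1_norm (y - x)"
      using lipschitz[of x y] lipschitz[of y x] xy by simp
    moreover have "0 < l1_norm (y - x)"
      using l1_norm_nonneg[of "y - x"] l1_norm_eq_0_iff[of "y - x"] xy by simp
    ultimately show ?thesis
      by (simp add: zero_le_mult_iff)
  qed
  then consider "L = 0" | "0 < L"
    by linarith
  then show ?thesis
  proof cases
    assume L: "L = 0"
    have const: "f z = f x" if "z \<in> S \<times> A" for z
      using lipschitz[of x z] lipschitz[of z x] xy that L by simp
    have "(\<integral>z. f z \<partial>\<rho>\<^sub>1) = (\<integral>z. f x \<partial>\<rho>\<^sub>1)" "(\<integral>z. f z \<partial>\<rho>\<^sub>2) = (\<integral>z. f x \<partial>\<rho>\<^sub>2)"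
      by (rule Bochner_Integration.integral_cong[OF refl const], simp only: space)+
    \<comment> \<open>The integral of a constant is that constant times \<open>measure\<close>,
      which is determined by \<open>emeasure\<close>, including the value 0 for infinite
      mass.\<close>
    then have "(\<integral>z. f z \<partial>\<rho>\<^sub>1) = (\<integral>z. f z \<partial>\<rho>\<^sub>2)"
      using mass by (simp add: space measure_def)
    \<comment> \<open>In \<open>ereal\<close>, zero times infinity is zero, so the transport term
      vanishes even for infinite \<open>W1\<close>.\<close>
    then show ?thesis
      using L by (simp flip: zero_ereal_def)
  next
    assume L: "0 < L"
    have bound: "ennreal (((\<integral>x. f x \<partial>\<rho>\<^sub>2) - (\<integral>x. f x \<partial>\<rho>\<^sub>1)) / L) \<le> W1 \<rho>\<^sub>1 \<rho>\<^sub>2"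
      using lipschitz L integrable by (intro lipschitz_integral_diff_le_W1) (auto simp: space)
    show ?thesis
    proof (cases "W1 \<rho>\<^sub>1 \<rho>\<^sub>2")
      case (real w)
      \<comment> \<open>Truncation of negative values by \<open>ennreal\<close> loses nothing here,
        because \<open>w\<close> is nonnegative.\<close>
      with bound have "((\<integral>x. f x \<partial>\<rho>\<^sub>2) - (\<integral>x. f x \<partial>\<rho>\<^sub>1)) / L \<le> w"
        by (simp)
      then have "(\<integral>x. f x \<partial>\<rho>\<^sub>2) - L * w \<le> (\<integral>x. f x \<partial>\<rho>\<^sub>1)"
        using L by (simp add: divide_le_eq algebra_simps)
      then show ?thesis
        using real by simp
    next
      case top
      \<comment> \<open>With \<open>L\<close> positive and infinite cost, the right-hand side is
        minus infinity.\<close>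
      then show ?thesis
        using L by (simp add: top_ereal_def)
    qed
  qed
qed

end
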